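(* Let $\mathcal{C}$ be a hereditary class of cographs. Then $\mathcal{C}$ has bounded linear clique-width if and only if $\mathcal{C}$ contains neither all quasi-threshold graphs nor the complements of all quasi-threshold graphs. That is: there is a constant $c$ with $\operatorname{lcw}(G)\le c$ for all $G\in\mathcal{C}$ if and only if some quasi-threshold graph is not in $\mathcal{C}$ and the complement of some quasi-threshold graph is not in $\mathcal{C}$.
   Context: All graphs are finite and simple and have at least one vertex. A hereditary class is a set of graphs closed under isomorphism and under taking induced subgraphs. The join $G\ast H$ of vertex-disjoint graphs $G,H$ is obtained from the disjoint union $G\cup H$ by adding all edges between $G$ and $H$. A cograph is a graph that can be built, starting with $K_1$, by repeatedly taking the disjoint union or join of two cographs (equivalently, a graph with no induced $P_4$). A quasi-threshold graph is a graph that can be built, starting with $K_1$, by repeatedly taking the disjoint union of two quasi-threshold graphs, or the join of a quasi-threshold graph with $K_1$ (equivalently, a graph with no induced $P_4$ or $C_4$). The linear clique-width $\operatorname{lcw}(G)$ of a graph $G$ is the size of the smallest alphabet $\Sigma$ such that $G$ can be constructed (starting from nothing) by a sequence of the following operations: (1) add a new vertex labeled by a letter in $\Sigma$; (2) for letters $i\ne j$, add edges between all vertices currently labeled $i$ and all vertices currently labeled $j$; (3) give all vertices currently labeled $i$ the label $j$. A class has bounded linear clique-width if $\operatorname{lcw}$ is bounded by a constant on its members. *)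

theory Defs
  imports Main
begin

type_synonym 'a sgraph = "'a set \<times> 'a set set"

abbreviation verts :: "'a sgraph \<Rightarrow> 'a set" where "verts G \<equiv> fst G"
abbreviation edges :: "'a sgraph \<Rightarrow> 'a set set" where "edges G \<equiv> snd G"

definition is_graph :: "'a sgraph \<Rightarrow> bool" where
  "is_graph G \<longleftrightarrow> finite (verts G) \<and> verts G \<noteq> {} \<and>
     (\<forall>e\<in>edges G. e \<subseteq> verts G \<and> card e = 2)"

definition graph_iso :: "'a sgraph \<Rightarrow> 'b sgraph \<Rightarrow> bool" where
  "graph_iso G H \<longleftrightarrow> (\<exists>f. bij_betw f (verts G) (verts H) \<and>
     (\<forall>u\<in>verts G. \<forall>v\<in>verts G. {u, v} \<in> edges G \<longleftrightarrow> {f u, f v} \<in> edges H))"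

definition induced :: "'a sgraph \<Rightarrow> 'a set \<Rightarrow> 'a sgraph" where
  "induced G W = (W, {e \<in> edges G. e \<subseteq> W})"

definition graph_union :: "'a sgraph \<Rightarrow> 'a sgraph \<Rightarrow> 'a sgraph" where
  "graph_union G H = (verts G \<union> verts H, edges G \<union> edges H)"

definition graph_join :: "'a sgraph \<Rightarrow> 'a sgraph \<Rightarrow> 'a sgraph" where
  "graph_join G H = (verts G \<union> verts H,
     edges G \<union> edges H \<union> {{u, v} | u v. u \<in> verts G \<and> v \<in> verts H})"

definition graph_compl :: "'a sgraph \<Rightarrow> 'a sgraph" where
  "graph_compl G = (verts G, {e. e \<subseteq> verts G \<and> card e = 2 \<and> e \<notin> edges G})"

abbreviation K1 :: "'a \<Rightarrow> 'a sgraph" where "K1 v \<equiv> ({v}, {})"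

definition hereditary :: "'a sgraph set \<Rightarrow> bool" where
  "hereditary C \<longleftrightarrow>
     (\<forall>G\<in>C. is_graph G) \<and>
     (\<forall>G\<in>C. \<forall>H. is_graph H \<and> graph_iso G H \<longrightarrow> H \<in> C) \<and>
     (\<forall>G\<in>C. \<forall>W. W \<subseteq> verts G \<and> W \<noteq> {} \<longrightarrow> induced G W \<in> C)"

inductive cograph :: "'a sgraph \<Rightarrow> bool" where
  "cograph (K1 v)"
| "cograph G \<Longrightarrow> cograph H \<Longrightarrow> verts G \<inter> verts H = {} \<Longrightarrow> cograph (graph_union G H)"
| "cograph G \<Longrightarrow> cograph H \<Longrightarrow> verts G \<inter> verts H = {} \<Longrightarrow> cograph (graph_join G H)"

inductive quasi_threshold :: "'a sgraph \<Rightarrow> bool" where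
  "quasi_threshold (K1 v)"
| "quasi_threshold G \<Longrightarrow> quasi_threshold H \<Longrightarrow> verts G \<inter> verts H = {} \<Longrightarrow>
     quasi_threshold (graph_union G H)"
| "quasi_threshold G \<Longrightarrow> v \<notin> verts G \<Longrightarrow> quasi_threshold (graph_join G (K1 v))"

(* lcw_built S G l: some sequence of operations over the alphabet S yields the graph G with
   current labeling l; l is a partial map whose domain is the set of vertices of G. *)
inductive lcw_built :: "'l set \<Rightarrow> 'a sgraph \<Rightarrow> ('a \<Rightarrow> 'l option) \<Rightarrow> bool" for S where
  empty: "lcw_built S ({}, {}) (\<lambda>_. None)"
| add_vertex: "lcw_built S (V, E) l \<Longrightarrow> v \<notin> V \<Longrightarrow> i \<in> S \<Longrightarrow>
     lcw_built S (insert v V, E) (l(v := Some i))"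
| add_edges: "lcw_built S (V, E) l \<Longrightarrow> i \<in> S \<Longrightarrow> j \<in> S \<Longrightarrow> i \<noteq> j \<Longrightarrow>
     lcw_built S (V, E \<union> {{u, v} | u v. l u = Some i \<and> l v = Some j}) l"
| relabel: "lcw_built S (V, E) l \<Longrightarrow> i \<in> S \<Longrightarrow> j \<in> S \<Longrightarrow>
     lcw_built S (V, E) (\<lambda>v. if l v = Some i then Some j else l v)"

definition lcw_constructible :: "'l set \<Rightarrow> 'a sgraph \<Rightarrow> bool" where
  "lcw_constructible S G \<longleftrightarrow> (\<exists>l. lcw_built S G l)"

(* Letters are drawn from nat; this loses nothing, as alphabets are finite. *)
definition lcw :: "'a sgraph \<Rightarrow> nat" where
  "lcw G = (LEAST k. \<exists>S :: nat set. finite S \<and> card S = k \<and> lcw_constructible S G)"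

definition bounded_lcw :: "'a sgraph set \<Rightarrow> bool" where
  "bounded_lcw C \<longleftrightarrow> (\<exists>c. \<forall>G\<in>C. lcw G \<le> c)"

(* The minimum in lcw is over a nonempty set: give every vertex its own letter. *)
lemma lcw_constructible_exists:
  assumes "is_graph G"
  shows "\<exists>S :: nat set. finite S \<and> lcw_constructible S G"
proof -
  obtain V E where G: "G = (V, E)" by (cases G)
  have fin: "finite V" and E: "\<And>e. e \<in> E \<Longrightarrow> e \<subseteq> V \<and> card e = 2"
    using assms by (auto simp: is_graph_def G)
  obtain f :: "'a \<Rightarrow> nat" where f: "inj_on f V"
    using finite_imp_inj_to_nat_seg[OF fin] by blast
  define l where "l W = (\<lambda>v. if v \<in> W then Some (f v) else None)" for W
  have vs: "W \<subseteq> V \<Longrightarrow> lcw_built (f ` V) (W, {}) (l W)" if "finite W" for W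
    using that
  proof (induction W)
    case empty
    then show ?case by (simp add: l_def lcw_built.empty)
  next
    case (insert x W)
    have "lcw_built (f ` V) (insert x W, {}) ((l W)(x := Some (f x)))"
      using insert by (intro lcw_built.add_vertex) auto
    moreover have "(l W)(x := Some (f x)) = l (insert x W)" by (auto simp: l_def)
    ultimately show ?case by simp
  qed
  have es: "F \<subseteq> E \<Longrightarrow> lcw_built (f ` V) (V, F) (l V)" if "finite F" for F
    using that
  proof (induction F)
    case empty
    then show ?case using vs fin by blast
  next
    case (insert e F)
    obtain u v where uv: "e = {u, v}" "u \<noteq> v" "u \<in> V" "v \<in> V"
      using E[of e] insert.prems by (auto simp: card_2_iff)
    have "{{a, b} | a b. l V a = Some (f u) \<and> l V b = Some (f v)} = {e}"
      using uv f by (auto simp: l_def inj_on_def split: if_splits)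
    moreover have "lcw_built (f ` V)
        (V, F \<union> {{a, b} | a b. l V a = Some (f u) \<and> l V b = Some (f v)}) (l V)"
      using insert uv f by (intro lcw_built.add_edges) (auto simp: inj_on_def)
    ultimately show ?case by simp
  qed
  have "finite E" using E fin by (meson Pow_iff finite_Pow_iff finite_subset subsetI)
  then have "lcw_built (f ` V) G (l V)" using es G by blast
  then show ?thesis using fin unfolding lcw_constructible_def by blast
qed

end

theory Submission
  imports Defs
begin

text \<open>Every quasi-threshold graph embeds into a universal one \<open>E k\<close>, where \<open>E (k + 1)\<close> is two
  disjoint copies of \<open>E k\<close> joined to a vertex. If the class excludes \<open>E a\<close> and the complement of
  \<open>E b\<close>, then the cotrees of its members have Horton--Strahler number (for a suitable order of
  the unions and joins) at most \<open>a + b + 1\<close>, and this bounds linear clique-width. Conversely, in a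
  construction with \<open>c\<close> letters the vertices present at any time have at most \<open>c\<close> distinct
  neighbourhoods among the later vertices. This property is invariant under complementation, and
  it fails for \<open>E (2 * c + 1)\<close>.\<close>

section \<open>Rich vertex sets and the universality of \<open>E k\<close>\<close>

definition separated :: "('a \<Rightarrow> 'a \<Rightarrow> bool) \<Rightarrow> ('a set \<Rightarrow> bool) \<Rightarrow> 'a set \<Rightarrow> bool" where
  "separated R P W \<longleftrightarrow> (\<exists>U1 U2. U1 \<subseteq> W \<and> U2 \<subseteq> W \<and> U1 \<inter> U2 = {} \<and>
     (\<forall>x\<in>U1. \<forall>y\<in>U2. \<not> R x y) \<and> P U1 \<and> P U2)"

text \<open>For symmetric irreflexive \<open>R\<close> this says that \<open>E k\<close> occurs
  inside \<open>W\<close> as an induced subgraph of the graph with adjacency \<open>R\<close>. Using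
  a relation instead of a graph lets one notion serve a graph and its complement, and the set
  \<open>W\<close> replaces passing to induced subgraphs.\<close>

primrec rich :: "('a \<Rightarrow> 'a \<Rightarrow> bool) \<Rightarrow> nat \<Rightarrow> 'a set \<Rightarrow> bool" where
  "rich R 0 W \<longleftrightarrow> W \<noteq> {}"
| "rich R (Suc k) W \<longleftrightarrow>
     (\<exists>v\<in>W. \<exists>U\<subseteq>W. v \<notin> U \<and> (\<forall>x\<in>U. R v x) \<and> separated R (rich R k) U)"

lemma separated_mono: "separated R P W \<Longrightarrow> W \<subseteq> W' \<Longrightarrow> separated R P W'"
  unfolding separated_def by (meson subset_trans)

lemma rich_mono: "rich R k W \<Longrightarrow> W \<subseteq> W' \<Longrightarrow> rich R k W'"
proof (cases k)
  case (Suc j)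
  assume "rich R k W" "W \<subseteq> W'"
  then show ?thesis unfolding Suc rich.simps by (meson subsetD subset_trans)
qed auto

lemma separated_rich_imp: "separated R (rich R k) W \<Longrightarrow> rich R k W"
  unfolding separated_def using rich_mono by blast

lemma rich_Suc_separated: "rich R (Suc k) W \<Longrightarrow> separated R (rich R k) W"
  by (auto intro: separated_mono)

lemma rich_Suc_imp: "rich R (Suc k) W \<Longrightarrow> rich R k W"
  by (rule separated_rich_imp[OF rich_Suc_separated])

lemma rich_antimono: "rich R k W \<Longrightarrow> j \<le> k \<Longrightarrow> rich R j W"
  by (induction k) (auto simp: le_Suc_eq simp del: rich.simps dest: rich_Suc_imp)

lemma rich_nonempty: "rich R k W \<Longrightarrow> W \<noteq> {}"
  using rich_antimono[of R k W 0] by simp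

lemma rich_cong_imp:
  "rich R k W \<Longrightarrow> (\<And>x y. x \<in> W \<Longrightarrow> y \<in> W \<Longrightarrow> R x y \<longleftrightarrow> R' x y) \<Longrightarrow> rich R' k W"
proof (induction k arbitrary: W)
  case 0
  then show ?case by simp
next
  case (Suc k)
  obtain v U U1 U2 where *: "v \<in> W" "U \<subseteq> W" "v \<notin> U" "\<forall>x\<in>U. R v x"
    "U1 \<subseteq> U" "U2 \<subseteq> U" "U1 \<inter> U2 = {}" "\<forall>x\<in>U1. \<forall>y\<in>U2. \<not> R x y"
    "rich R k U1" "rich R k U2"
    using Suc.prems(1) unfolding rich.simps separated_def by blast
  have "rich R' k U1" "rich R' k U2"
    using * by (intro Suc.IH Suc.prems(2); blast)+
  moreover have "\<forall>x\<in>U. R' v x" "\<forall>x\<in>U1. \<forall>y\<in>U2. \<not> R' x y"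
    using * Suc.prems(2) by blast+
  ultimately have "separated R' (rich R' k) U"
    using * unfolding separated_def by blast
  then show ?case
    using * \<open>\<forall>x\<in>U. R' v x\<close> unfolding rich.simps by blast
qed

lemma separated_rich_cong_imp:
  assumes "separated R (rich R k) W" "\<And>x y. x \<in> W \<Longrightarrow> y \<in> W \<Longrightarrow> R x y \<longleftrightarrow> R' x y"
  shows "separated R' (rich R' k) W"
proof -
  obtain U1 U2 where *: "U1 \<subseteq> W" "U2 \<subseteq> W" "U1 \<inter> U2 = {}" "\<forall>x\<in>U1. \<forall>y\<in>U2. \<not> R x y"
    "rich R k U1" "rich R k U2"
    using assms(1) unfolding separated_def by blast
  have "rich R' k U1" "rich R' k U2"
    using * assms(2) by (blast intro: rich_cong_imp[where R = R])+
  moreover have "\<forall>x\<in>U1. \<forall>y\<in>U2. \<not> R' x y" using * assms(2) by blast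
  ultimately show ?thesis using * unfolding separated_def by blast
qed

lemma quasi_threshold_is_graph: "quasi_threshold G \<Longrightarrow> is_graph G"
proof (induction rule: quasi_threshold.induct)
  case (3 G v)
  then show ?case unfolding is_graph_def graph_join_def
    by (auto simp: card_2_iff)
qed (auto simp: is_graph_def graph_union_def)

text \<open>A union is hosted by the two separated copies of the next level; in a join with a
  vertex, the root hosts that vertex and the set below it hosts the rest. The level \<open>k\<close>
  is fixed before \<open>R\<close> and \<open>W\<close>, so that a single level works for a whole
  class of graphs.\<close>

lemma quasi_threshold_embeds_in_rich:
  fixes H :: "'a sgraph"
  assumes "quasi_threshold H"
  shows "\<exists>k. \<forall>(R :: 'b \<Rightarrow> 'b \<Rightarrow> bool) W. rich R k W \<longrightarrow> symp R \<longrightarrow> irreflp R \<longrightarrow>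
    (\<exists>f. inj_on f (verts H) \<and> f ` verts H \<subseteq> W \<and>
      (\<forall>u\<in>verts H. \<forall>v\<in>verts H. {u, v} \<in> edges H \<longleftrightarrow> R (f u) (f v)))"
    (is "\<exists>k. \<forall>R W. rich R k W \<longrightarrow> symp R \<longrightarrow> irreflp R \<longrightarrow> (\<exists>f. ?emb f H R W)")
  using assms
proof (induction rule: quasi_threshold.induct)
  case (1 v)
  have "\<exists>f. ?emb f (K1 v) R W" if "rich R 0 W" "symp R" "irreflp R" for R :: "'b \<Rightarrow> 'b \<Rightarrow> bool" and W
  proof -
    obtain w where "w \<in> W" using \<open>rich R 0 W\<close> by auto
    then show ?thesis
      using \<open>irreflp R\<close> by (intro exI[of _ "\<lambda>_. w"]) (auto dest: irreflpD)
  qed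
  then show ?case by blast
next
  case (2 G H)
  obtain i where i: "\<forall>R W. rich R i W \<longrightarrow> symp R \<longrightarrow> irreflp R \<longrightarrow> (\<exists>f. ?emb f G R W)"
    using "2.IH"(1) by (rule exE)
  obtain j where j: "\<forall>R W. rich R j W \<longrightarrow> symp R \<longrightarrow> irreflp R \<longrightarrow> (\<exists>f. ?emb f H R W)"
    using "2.IH"(2) by (rule exE)
  have gr: "\<And>e. e \<in> edges G \<Longrightarrow> e \<subseteq> verts G" "\<And>e. e \<in> edges H \<Longrightarrow> e \<subseteq> verts H"
    using 2(1,2)[THEN quasi_threshold_is_graph] unfolding is_graph_def by blast+
  have "\<exists>f. ?emb f (graph_union G H) R W"
    if rW: "rich R (Suc (max i j)) W" and R: "symp R" "irreflp R" for R :: "'b \<Rightarrow> 'b \<Rightarrow> bool" and W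
  proof -
    obtain U1 U2 where U: "U1 \<subseteq> W" "U2 \<subseteq> W" "U1 \<inter> U2 = {}" "\<forall>x\<in>U1. \<forall>y\<in>U2. \<not> R x y"
      "rich R (max i j) U1" "rich R (max i j) U2"
      using rich_Suc_separated[OF rW] unfolding separated_def by (elim exE conjE)
    have rU: "rich R i U1" "rich R j U2"
      using U(5,6) by (auto elim: rich_antimono)
    obtain f where f: "inj_on f (verts G)" "f ` verts G \<subseteq> U1"
      "\<forall>u\<in>verts G. \<forall>v\<in>verts G. {u, v} \<in> edges G \<longleftrightarrow> R (f u) (f v)"
      using i[rule_format, OF rU(1) R] by (elim exE conjE)
    obtain g where g: "inj_on g (verts H)" "g ` verts H \<subseteq> U2"
      "\<forall>u\<in>verts H. \<forall>v\<in>verts H. {u, v} \<in> edges H \<longleftrightarrow> R (g u) (g v)"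
      using j[rule_format, OF rU(2) R] by (elim exE conjE)
    define h where "h x = (if x \<in> verts G then f x else g x)" for x
    have hG: "h x = f x" "f x \<in> U1" if "x \<in> verts G" for x using that f(2) by (auto simp: h_def)
    have hH: "h x = g x" "g x \<in> U2" if "x \<in> verts H" for x
      using that g(2) \<open>verts G \<inter> verts H = {}\<close> by (auto simp: h_def)
    have "inj_on h (verts G)" "inj_on h (verts H)"
      using f(1) g(1) hG(1) hH(1) by (simp_all cong: inj_on_cong)
    moreover have "h ` verts G \<inter> h ` verts H = {}" using hG hH U(3) by force
    ultimately have "inj_on h (verts G \<union> verts H)" by (auto simp: inj_on_Un)
    moreover have "h ` (verts G \<union> verts H) \<subseteq> W"
      using hG hH U by auto
    moreover have "{u, v} \<in> edges G \<union> edges H \<longleftrightarrow> R (h u) (h v)"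
      if uv: "u \<in> verts G \<union> verts H" "v \<in> verts G \<union> verts H" for u v
    proof -
      consider "u \<in> verts G" "v \<in> verts G" | "u \<in> verts H" "v \<in> verts H"
        | "u \<in> verts G" "v \<in> verts H" | "u \<in> verts H" "v \<in> verts G" using uv by blast
      then show ?thesis
      proof cases
        case 1
        then have "{u, v} \<notin> edges H" using gr(2)[of "{u,v}"] \<open>verts G \<inter> verts H = {}\<close> by blast
        then show ?thesis using 1 f(3) hG(1) by auto
      next
        case 2
        then have "{u, v} \<notin> edges G" using gr(1)[of "{u,v}"] \<open>verts G \<inter> verts H = {}\<close> by blast
        then show ?thesis using 2 g(3) hH(1) by auto
      next
        case 3
        then have "{u, v} \<notin> edges G \<union> edges H"
          using gr[of "{u,v}"] \<open>verts G \<inter> verts H = {}\<close> by blast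
        then show ?thesis using 3 U(4) hG hH by auto
      next
        case 4
        then have "{u, v} \<notin> edges G \<union> edges H"
          using gr[of "{u,v}"] \<open>verts G \<inter> verts H = {}\<close> by blast
        then show ?thesis using 4 U(4) hG hH R(1) by (metis sympD)
      qed
    qed
    ultimately show ?thesis by (intro exI[of _ h]) (simp add: graph_union_def)
  qed
  then show ?case by blast
next
  case (3 G v)
  obtain i where i: "\<forall>R W. rich R i W \<longrightarrow> symp R \<longrightarrow> irreflp R \<longrightarrow> (\<exists>f. ?emb f G R W)"
    using "3.IH" by (rule exE)
  have gr: "\<And>e. e \<in> edges G \<Longrightarrow> e \<subseteq> verts G"
    using 3(1)[THEN quasi_threshold_is_graph] unfolding is_graph_def by blast
  have "\<exists>f. ?emb f (graph_join G (K1 v)) R W"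
    if rW: "rich R (Suc i) W" and R: "symp R" "irreflp R" for R :: "'b \<Rightarrow> 'b \<Rightarrow> bool" and W
  proof -
    obtain w U where U: "w \<in> W" "U \<subseteq> W" "w \<notin> U" "\<forall>x\<in>U. R w x" "separated R (rich R i) U"
      using rW unfolding rich.simps by blast
    obtain f where f: "inj_on f (verts G)" "f ` verts G \<subseteq> U"
      "\<forall>u\<in>verts G. \<forall>v\<in>verts G. {u, v} \<in> edges G \<longleftrightarrow> R (f u) (f v)"
      using i[rule_format, OF separated_rich_imp[OF U(5)] R] by (elim exE conjE)
    define h where "h x = (if x = v then w else f x)" for x
    have hG: "h x = f x" "f x \<in> U" "x \<noteq> v" if "x \<in> verts G" for x
      using that f(2) \<open>v \<notin> verts G\<close> by (auto simp: h_def)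
    have hv: "h v = w" by (simp add: h_def)
    have "inj_on h (insert v (verts G))"
    proof -
      have "inj_on h (verts G)" using f(1) hG(1) by (simp cong: inj_on_cong)
      moreover have "h v \<notin> h ` verts G" using hG hv U(3) by force
      ultimately show ?thesis using \<open>v \<notin> verts G\<close> by simp
    qed
    moreover have "h ` (insert v (verts G)) \<subseteq> W"
      using hG hv U(1,2) by auto
    moreover have "{x, y} \<in> edges (graph_join G (K1 v)) \<longleftrightarrow> R (h x) (h y)"
      if xy: "x \<in> insert v (verts G)" "y \<in> insert v (verts G)" for x y
    proof -
      have E: "{x, y} \<in> edges (graph_join G (K1 v)) \<longleftrightarrow>
          {x, y} \<in> edges G \<or> (x \<in> verts G \<and> y = v) \<or> (y \<in> verts G \<and> x = v)"
        by (auto simp: graph_join_def doubleton_eq_iff)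
      have nv: "v \<in> e \<Longrightarrow> e \<notin> edges G" for e using gr \<open>v \<notin> verts G\<close> by blast
      consider "x = v" "y = v" | "x = v" "y \<in> verts G" | "x \<in> verts G" "y = v"
        | "x \<in> verts G" "y \<in> verts G" using xy by blast
      then show ?thesis
      proof cases
        case 1
        then show ?thesis using E nv[of "{x,y}"] \<open>v \<notin> verts G\<close> R(2) by (auto dest: irreflpD)
      next
        case 2
        then show ?thesis using E U(4) hG hv by auto
      next
        case c: 3
        then show ?thesis using E U(4) hG hv R(1) by (metis sympD)
      next
        case 4
        then show ?thesis using E f(3) hG by auto
      qed
    qed
    ultimately show ?thesis by (intro exI[of _ h]) (simp add: graph_join_def)
  qed
  then show ?case by blast
qed

section \<open>Upper bound: cographs of small Horton-Strahler number\<close>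

definition rel :: "bool \<Rightarrow> 'a sgraph \<Rightarrow> 'a \<Rightarrow> 'a \<Rightarrow> bool" where
  "rel s G u v \<longleftrightarrow> u \<noteq> v \<and> ({u, v} \<in> edges G \<longleftrightarrow> s)"

text \<open>With respect to \<open>rel s\<close>, adjacency in the graph or in its complement,
  \<open>comb s\<close> acts as the disjoint union and \<open>comb (\<not> s)\<close> as the join.
  Complementation becomes negation of flags, so unions and joins share one argument.\<close>

definition comb :: "bool \<Rightarrow> 'a sgraph \<Rightarrow> 'a sgraph \<Rightarrow> 'a sgraph" where
  "comb s G H = (if s then graph_union G H else graph_join G H)"

lemma symp_rel: "symp (rel s G)"
  by (auto simp: symp_def rel_def insert_commute)

lemma irreflp_rel: "irreflp (rel s G)"
  by (auto simp: irreflp_def rel_def)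

lemma verts_comb [simp]: "verts (comb s G H) = verts G \<union> verts H"
  by (simp add: comb_def graph_union_def graph_join_def)

lemma comb_commute: "comb s G H = comb s H G"
  unfolding comb_def graph_union_def graph_join_def
  by (auto simp: Un_ac insert_commute)

lemma comb_assoc: "comb s (comb s G H) K = comb s G (comb s H K)"
  unfolding comb_def graph_union_def graph_join_def by auto

lemma rel_comb:
  assumes "is_graph G" "is_graph H" "verts G \<inter> verts H = {}"
  shows "x \<in> verts G \<Longrightarrow> y \<in> verts G \<Longrightarrow> rel t (comb s G H) x y \<longleftrightarrow> rel t G x y"
    and "x \<in> verts H \<Longrightarrow> y \<in> verts H \<Longrightarrow> rel t (comb s G H) x y \<longleftrightarrow> rel t H x y"
    and "x \<in> verts G \<Longrightarrow> y \<in> verts H \<Longrightarrow> rel t (comb s G H) x y \<longleftrightarrow> s \<noteq> t"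
proof -
  have gr: "{u, v} \<in> edges G \<Longrightarrow> u \<in> verts G \<and> v \<in> verts G"
    "{u, v} \<in> edges H \<Longrightarrow> u \<in> verts H \<and> v \<in> verts H" for u v
    using assms by (auto simp: is_graph_def)
  have E: "{x, y} \<in> edges (comb s G H) \<longleftrightarrow> {x, y} \<in> edges G \<or> {x, y} \<in> edges H \<or>
      \<not> s \<and> (x \<in> verts G \<and> y \<in> verts H \<or> y \<in> verts G \<and> x \<in> verts H)" for x y
    by (auto simp: comb_def graph_union_def graph_join_def doubleton_eq_iff)
  show "x \<in> verts G \<Longrightarrow> y \<in> verts G \<Longrightarrow> rel t (comb s G H) x y \<longleftrightarrow> rel t G x y"
    using gr assms(3) unfolding rel_def E by blast
  show "x \<in> verts H \<Longrightarrow> y \<in> verts H \<Longrightarrow> rel t (comb s G H) x y \<longleftrightarrow> rel t H x y"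
    using gr assms(3) unfolding rel_def E by blast
  show "x \<in> verts G \<Longrightarrow> y \<in> verts H \<Longrightarrow> rel t (comb s G H) x y \<longleftrightarrow> s \<noteq> t"
    using gr assms(3) unfolding rel_def E by blast
qed

lemma is_graph_comb:
  assumes "is_graph G" "is_graph H" "verts G \<inter> verts H = {}"
  shows "is_graph (comb s G H)"
proof -
  have "card {u, v} = 2" if "u \<in> verts G" "v \<in> verts H" for u v
    using that assms(3) by (metis IntI card_2_iff empty_iff)
  then show ?thesis
    using assms(1,2) unfolding is_graph_def comb_def graph_union_def graph_join_def by auto
qed

text \<open>The Horton--Strahler number of a cotree, which bounds linear clique-width: the part of
  smaller width is built last, while the rest waits under a single spare letter.\<close>

inductive strahler :: "nat \<Rightarrow> 'a sgraph \<Rightarrow> bool" where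
  leaf: "strahler (Suc n) (K1 v)"
| node: "strahler (Suc n) G \<Longrightarrow> strahler n H \<Longrightarrow> verts G \<inter> verts H = {} \<Longrightarrow>
    strahler (Suc n) (comb s G H)"
| up: "strahler n G \<Longrightarrow> strahler (Suc n) G"

lemma strahler_pos: "strahler n G \<Longrightarrow> 0 < n"
  by (cases rule: strahler.cases) auto

text \<open>The induction needs a previously built graph \<open>(V, E)\<close> in the background.
  Its labels are at least \<open>n\<close>, so work with the letters below \<open>n\<close> cannot
  touch it. The new part ends with the single label 0, so that one letter suffices to set it aside
  later.\<close>

lemma strahler_built:
  assumes "strahler n G" "lcw_built {..<N} (V, E) l" "n \<le> N" "V \<inter> verts G = {}"
    "\<And>v i. l v = Some i \<Longrightarrow> n \<le> i" "dom l = V"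
  shows "lcw_built {..<N} (V \<union> verts G, E \<union> edges G) (\<lambda>v. if v \<in> verts G then Some 0 else l v)"
  using assms
proof (induction arbitrary: V E l rule: strahler.induct)
  case (leaf n v)
  have "lcw_built {..<N} (insert v V, E) (l(v := Some 0))"
    using leaf by (intro lcw_built.add_vertex) auto
  moreover have "l(v := Some 0) = (\<lambda>x. if x \<in> {v} then Some 0 else l x)" by auto
  ultimately show ?case by simp
next
  case (up n G)
  then show ?case using Suc_leD by blast
next
  case (node n G H s)
  define l1 where "l1 = (\<lambda>v. if v \<in> verts G then Some 0 else l v)"
  define l2 where "l2 = (\<lambda>v. if v \<in> verts G then Some n else l v)"
  define l3 where "l3 = (\<lambda>v. if v \<in> verts H then Some 0 else l2 v)"
  have n: "0 < n" using node strahler_pos by blast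
  have lV: "l v = None" if "v \<in> verts G \<union> verts H" for v
    using node.prems that by (auto simp: domIff)
  have l: "l v \<noteq> Some i" if "i \<le> n" for v i using node.prems(4)[of v i] that by auto
  have 1: "lcw_built {..<N} (V \<union> verts G, E \<union> edges G) l1"
    unfolding l1_def using node.prems by (intro node.IH(1)) auto
  \<comment> \<open>Set \<open>G\<close> aside under the letter \<open>n\<close>; this frees the
    letters below \<open>n\<close>, which are enough for \<open>H\<close>.\<close>
  have "lcw_built {..<N} (V \<union> verts G, E \<union> edges G)
     (\<lambda>v. if l1 v = Some 0 then Some n else l1 v)"
    using n node.prems by (intro lcw_built.relabel[OF 1]) auto
  moreover have "(\<lambda>v. if l1 v = Some 0 then Some n else l1 v) = l2"
    using l[of 0] by (auto simp: l1_def l2_def)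
  ultimately have 2: "lcw_built {..<N} (V \<union> verts G, E \<union> edges G) l2" by simp
  have 3: "lcw_built {..<N} (V \<union> verts G \<union> verts H, E \<union> edges G \<union> edges H) l3"
    unfolding l3_def
  proof (rule node.IH(2)[OF 2])
    show "n \<le> i" if "l2 v = Some i" for v i
      using that node.prems(4)[of v i] by (auto simp: l2_def split: if_splits)
    show "dom l2 = V \<union> verts G" using node.prems by (auto simp: l2_def split: if_splits)
  qed (use node in auto)
  \<comment> \<open>Older vertices have labels above \<open>n\<close>, and \<open>n\<close> is not
    0. Hence these label classes are exactly \<open>H\<close> and \<open>G\<close>, and joining the
    two letters adds exactly the edges of the join.\<close>
  have H: "{v. l3 v = Some 0} = verts H" using l[of 0] n by (auto simp: l3_def l2_def)
  have G: "{v. l3 v = Some n} = verts G" using l[of n] n node.hyps by (auto simp: l3_def l2_def)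
  have 4: "lcw_built {..<N} (V \<union> verts (comb s G H), E \<union> edges (comb s G H)) l3"
  proof (cases s)
    case True
    then show ?thesis using 3 by (simp add: comb_def graph_union_def Un_ac)
  next
    case False
    have "lcw_built {..<N} (V \<union> verts G \<union> verts H, E \<union> edges G \<union> edges H \<union>
        {{u, v} | u v. l3 u = Some n \<and> l3 v = Some 0}) l3"
      using n node.prems by (intro lcw_built.add_edges[OF 3]) auto
    moreover have "{{u, v} | u v. l3 u = Some n \<and> l3 v = Some 0} =
        {{u, v} | u v. u \<in> verts G \<and> v \<in> verts H}"
      using G H by blast
    ultimately show ?thesis using False by (simp add: comb_def graph_join_def Un_ac)
  qed
  have "lcw_built {..<N} (V \<union> verts (comb s G H), E \<union> edges (comb s G H))
     (\<lambda>v. if l3 v = Some n then Some 0 else l3 v)"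
    using n node.prems by (intro lcw_built.relabel[OF 4]) auto
  moreover have "(\<lambda>v. if l3 v = Some n then Some 0 else l3 v) =
      (\<lambda>v. if v \<in> verts (comb s G H) then Some 0 else l v)"
    using l[of n] by (auto simp: l3_def l2_def)
  ultimately show ?case by simp
qed

lemma strahler_lcw:
  assumes "strahler n G"
  shows "lcw G \<le> n"
proof -
  have "lcw_built {..<n} ({} \<union> verts G, {} \<union> edges G)
      (\<lambda>v. if v \<in> verts G then Some 0 else None)"
    by (rule strahler_built[OF assms lcw_built.empty]) auto
  then have "lcw_constructible {..<n} G"
    unfolding lcw_constructible_def by auto
  then have "\<exists>S :: nat set. finite S \<and> card S = n \<and> lcw_constructible S G"
    by (intro exI[of _ "{..<n}"]) simp
  then show ?thesis unfolding lcw_def by (rule Least_le)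
qed

text \<open>A union \<^term>\<open>comb True Z G\<close> needs no further letter if no single component of \<open>G\<close> is
  as wide as \<open>Z\<close>; hence the second claim, which is about excluding a connected graph. A connected
  \<open>G\<close> that contains a disconnected graph \<open>X\<close> has \<open>X\<close> inside one side of a join, so it also
  contains \<open>X\<close> joined to a single vertex.\<close>

lemma cograph_strahler:
  assumes "cograph G"
  shows "is_graph G \<and>
    (\<forall>s a b. \<not> separated (rel s G) (rich (rel s G) a) (verts G) \<longrightarrow>
      \<not> separated (rel (\<not> s) G) (rich (rel (\<not> s) G) b) (verts G) \<longrightarrow> strahler (Suc (a + b)) G) \<and>
    (\<forall>s a b Z. \<not> rich (rel s G) a (verts G) \<longrightarrow>
      \<not> separated (rel (\<not> s) G) (rich (rel (\<not> s) G) b) (verts G) \<longrightarrow>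
      strahler (Suc (a + b)) Z \<longrightarrow> verts Z \<inter> verts G = {} \<longrightarrow> strahler (Suc (a + b)) (comb s Z G))"
    (is "?P G")
proof -
  let ?sep = "\<lambda>s G a. separated (rel s G) (rich (rel s G) a) (verts G)"
  have step: "?P (comb t G H)" if PG: "?P G" and PH: "?P H" and dj: "verts G \<inter> verts H = {}"
    for G H :: "'a sgraph" and t
  proof -
    let ?K = "comb t G H"
    have gG: "is_graph G" and gH: "is_graph H"
      using PG[THEN conjunct1] PH[THEN conjunct1] .
    have G1: "strahler (Suc (a + b)) G" if "\<not> ?sep s G a" "\<not> ?sep (\<not> s) G b" for s a b
      using PG that by blast
    have H1: "strahler (Suc (a + b)) H" if "\<not> ?sep s H a" "\<not> ?sep (\<not> s) H b" for s a b
      using PH that by blast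
    have G2: "strahler (Suc (a + b)) (comb s Z G)"
      if "\<not> rich (rel s G) a (verts G)" "\<not> ?sep (\<not> s) G b"
        "strahler (Suc (a + b)) Z" "verts Z \<inter> verts G = {}" for s a b Z
      using PG that by blast
    have H2: "strahler (Suc (a + b)) (comb s Z H)"
      if "\<not> rich (rel s H) a (verts H)" "\<not> ?sep (\<not> s) H b"
        "strahler (Suc (a + b)) Z" "verts Z \<inter> verts H = {}" for s a b Z
      using PH that by blast
    note rc = rel_comb[OF gG gH dj]
    have sepG: "?sep s ?K a" if "?sep s G a" for s a
      using separated_mono[OF separated_rich_cong_imp[OF that, of "rel s ?K"]] rc(1)[of _ _ s t] by simp
    have sepH: "?sep s ?K a" if "?sep s H a" for s a
      using separated_mono[OF separated_rich_cong_imp[OF that, of "rel s ?K"]] rc(2)[of _ _ s t] by simp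
    have richG: "rich (rel s ?K) a (verts G)" if "rich (rel s G) a (verts G)" for s a
      using rich_cong_imp[OF that] rc(1) by blast
    have richH: "rich (rel s ?K) a (verts H)" if "rich (rel s H) a (verts H)" for s a
      using rich_cong_imp[OF that] rc(2) by blast
    have first_t: "strahler (Suc (a + b)) ?K" if a: "\<not> ?sep t ?K a" and b: "\<not> ?sep (\<not> t) ?K b" for a b
    proof -
      \<comment> \<open>For \<open>rel t\<close> nothing links \<open>G\<close> to \<open>H\<close>,
        so two rich sides would form a separated pair. The side that is not rich is then attached to
        the other one by the second claim.\<close>
      have "\<not> (rich (rel t G) a (verts G) \<and> rich (rel t H) a (verts H))"
      proof
        assume "rich (rel t G) a (verts G) \<and> rich (rel t H) a (verts H)"
        then have "?sep t ?K a"
          unfolding separated_def using richG richH dj rc(3)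
          by (intro exI[of _ "verts G"] exI[of _ "verts H"]) auto
        with a show False by blast
      qed
      then consider "\<not> rich (rel t H) a (verts H)" | "\<not> rich (rel t G) a (verts G)" by blast
      then show ?thesis
      proof cases
        case 1
        have "strahler (Suc (a + b)) G" using G1 a b sepG by blast
        then show ?thesis using H2[OF 1 _ _ dj] b sepH by blast
      next
        case 2
        have "strahler (Suc (a + b)) H" using H1 a b sepH by blast
        moreover have "verts H \<inter> verts G = {}" using dj by blast
        ultimately have "strahler (Suc (a + b)) (comb t H G)" using G2[OF 2] b sepG by blast
        then show ?thesis by (simp add: comb_commute)
      qed
    qed
    have first: "strahler (Suc (a + b)) ?K" if "\<not> ?sep s ?K a" "\<not> ?sep (\<not> s) ?K b" for s a b
    proof (cases "s = t")
      case True
      then show ?thesis using first_t that by blast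
    next
      case False
      \<comment> \<open>The first claim is symmetric under exchanging \<open>s\<close>,
        \<open>a\<close> with \<open>\<not> s\<close>, \<open>b\<close>.\<close>
      then have s: "s = (\<not> t)" by blast
      then have "strahler (Suc (b + a)) ?K" using that by (intro first_t) auto
      then show ?thesis by (simp add: add.commute)
    qed
    have second: "strahler (Suc (a + b)) (comb s Z ?K)"
      if a: "\<not> rich (rel s ?K) a (verts ?K)" and b: "\<not> ?sep (\<not> s) ?K b"
        and Z: "strahler (Suc (a + b)) Z" "verts Z \<inter> verts ?K = {}" for s a b Z
    proof (cases "s = t")
      case True
      \<comment> \<open>By associativity, \<open>G\<close> and \<open>H\<close> can be attached to
        \<open>Z\<close> one after the other, each without raising the width.\<close>
      have "\<not> rich (rel s G) a (verts G)" "\<not> rich (rel s H) a (verts H)"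
        using a richG richH rich_mono by (metis verts_comb Un_upper1 Un_upper2)+
      moreover have "verts Z \<inter> verts G = {}" "verts (comb s Z G) \<inter> verts H = {}"
        using Z dj by auto
      ultimately have "strahler (Suc (a + b)) (comb s (comb s Z G) H)"
        using G2[of s a b Z] H2[of s a b "comb s Z G"] b sepG sepH Z(1)
          \<open>\<not> rich (rel s G) a (verts G)\<close> \<open>\<not> rich (rel s H) a (verts H)\<close> by blast
      then show ?thesis using True by (simp add: comb_assoc)
    next
      case False
      \<comment> \<open>Level 0 only asks for a vertex, so a set that is not rich at level
        \<open>a\<close> forces \<open>a\<close> to be positive.\<close>
      obtain c where c: "a = Suc c"
        using a gG by (cases a) (auto simp: is_graph_def)
      have "\<not> ?sep s ?K c"
      proof
        assume "?sep s ?K c"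
        then obtain U1 U2 where U: "U1 \<subseteq> verts ?K" "U2 \<subseteq> verts ?K" "U1 \<inter> U2 = {}"
          "\<forall>x\<in>U1. \<forall>y\<in>U2. \<not> rel s ?K x y" "rich (rel s ?K) c U1" "rich (rel s ?K) c U2"
          unfolding separated_def by blast
        then have sep: "separated (rel s ?K) (rich (rel s ?K) c) (U1 \<union> U2)"
          unfolding separated_def by blast
        have ne: "U1 \<noteq> {}" "U2 \<noteq> {}" using U rich_nonempty by blast+
        have adj: "rel s ?K x y" "rel s ?K y x" if "x \<in> verts G" "y \<in> verts H" for x y
          using rc(3)[OF that] False symp_rel by (metis sympD)+
        \<comment> \<open>Each vertex of \<open>G\<close> is related to each vertex of
          \<open>H\<close>. A vertex of \<open>U1\<close> in \<open>G\<close> thus keeps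
          \<open>U2\<close> out of \<open>H\<close>, and then \<open>U2\<close> keeps
          \<open>U1\<close> out of \<open>H\<close>; likewise with the sides exchanged.\<close>
        have "U1 \<union> U2 \<subseteq> verts G \<or> U1 \<union> U2 \<subseteq> verts H"
          using U(1,2,4) ne adj unfolding verts_comb by blast
        then consider "U1 \<union> U2 \<subseteq> verts G" | "U1 \<union> U2 \<subseteq> verts H" by blast
        then have "rich (rel s ?K) (Suc c) (verts ?K)"
        proof cases
          case 1
          obtain v where "v \<in> verts H" using gH by (auto simp: is_graph_def)
          then show ?thesis using 1 adj sep dj unfolding rich.simps
            by (intro bexI[of _ v] exI[of _ "U1 \<union> U2"]) auto
        next
          case 2
          obtain v where "v \<in> verts G" using gG by (auto simp: is_graph_def)
          then show ?thesis using 2 adj sep dj unfolding rich.simps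
            by (intro bexI[of _ v] exI[of _ "U1 \<union> U2"]) auto
        qed
        with a c show False by blast
      qed
      \<comment> \<open>Here \<open>Suc (c + b)\<close> is \<open>a + b\<close>, one below the width
        of \<open>Z\<close>, as the rule \<open>node\<close> demands.\<close>
      then have "strahler (Suc (c + b)) ?K" using b by (intro first)
      then show ?thesis using Z c strahler.node by (metis add_Suc)
    qed
    show ?thesis using first second is_graph_comb[OF gG gH dj] by blast
  qed
  show ?thesis using assms
  proof (induction rule: cograph.induct)
    case (1 v)
    have "strahler (Suc (a + b)) (comb s Z (K1 v))"
      if Z: "\<not> rich (rel s (K1 v)) a {v}" "strahler (Suc (a + b)) Z" "verts Z \<inter> {v} = {}"
      for s a b Z
    proof -
      obtain c where "a = Suc c" using Z(1) by (cases a) auto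
      then show ?thesis using Z strahler.node[of "a + b" Z "K1 v" s] strahler.leaf[of "c + b" v] by simp
    qed
    moreover have "is_graph (K1 v)" by (simp add: is_graph_def)
    ultimately show ?case using strahler.leaf by auto
  next
    case (2 G H)
    then show ?case using step[of G H True] by (simp add: comb_def)
  next
    case (3 G H)
    then show ?case using step[of G H False] by (simp add: comb_def)
  qed
qed

section \<open>Excluded quasi-threshold graphs bound richness\<close>

lemma hereditary_embedding:
  assumes "hereditary C" "G \<in> C" "is_graph H" "inj_on f (verts H)" "f ` verts H \<subseteq> verts G"
    "\<And>u v. u \<in> verts H \<Longrightarrow> v \<in> verts H \<Longrightarrow> {u, v} \<in> edges H \<longleftrightarrow> {f u, f v} \<in> edges G"
  shows "H \<in> C"
proof -
  let ?K = "induced G (f ` verts H)"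
  have "?K \<in> C"
    using assms by (auto simp: hereditary_def is_graph_def)
  moreover have "graph_iso ?K H"
    unfolding graph_iso_def
  proof (intro exI conjI ballI)
    show "bij_betw (inv_into (verts H) f) (verts ?K) (verts H)"
      using assms(4) by (simp add: induced_def bij_betw_inv_into inj_on_imp_bij_betw)
    show "{u, v} \<in> edges ?K \<longleftrightarrow>
        {inv_into (verts H) f u, inv_into (verts H) f v} \<in> edges H"
      if "u \<in> verts ?K" "v \<in> verts ?K" for u v
      using that assms(4,6) by (auto simp: induced_def)
  qed
  ultimately show ?thesis using assms unfolding hereditary_def by blast
qed

lemma is_graph_compl: "is_graph G \<Longrightarrow> is_graph (graph_compl G)"
  by (auto simp: is_graph_def graph_compl_def)

text \<open>At the level that \<open>quasi_threshold_embeds_in_rich\<close> supplies for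
  \<open>H\<close>, a rich member of the class would contain \<open>H\<close>, or its complement if
  \<open>s\<close> is false, as an induced subgraph.\<close>

lemma excluded_not_rich:
  fixes C :: "'a sgraph set"
  assumes "hereditary C" "quasi_threshold H" "(if s then H else graph_compl H) \<notin> C"
  shows "\<exists>k. \<forall>G\<in>C. \<not> rich (rel s G) k (verts G)"
proof -
  obtain k where k: "\<forall>(R :: 'a \<Rightarrow> 'a \<Rightarrow> bool) W. rich R k W \<longrightarrow> symp R \<longrightarrow> irreflp R \<longrightarrow>
    (\<exists>f. inj_on f (verts H) \<and> f ` verts H \<subseteq> W \<and>
      (\<forall>u\<in>verts H. \<forall>v\<in>verts H. {u, v} \<in> edges H \<longleftrightarrow> R (f u) (f v)))"
    using quasi_threshold_embeds_in_rich[OF assms(2)] by (rule exE)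
  have H: "is_graph H" using assms(2) by (rule quasi_threshold_is_graph)
  have "\<not> rich (rel s G) k (verts G)" if "G \<in> C" for G
  proof
    assume rG: "rich (rel s G) k (verts G)"
    obtain f where "inj_on f (verts H) \<and> f ` verts H \<subseteq> verts G \<and>
      (\<forall>u\<in>verts H. \<forall>v\<in>verts H. {u, v} \<in> edges H \<longleftrightarrow> rel s G (f u) (f v))"
      using k[rule_format, OF rG symp_rel irreflp_rel] by (rule exE)
    then have f: "inj_on f (verts H)" "f ` verts H \<subseteq> verts G"
      "u \<in> verts H \<Longrightarrow> v \<in> verts H \<Longrightarrow> {u, v} \<in> edges H \<longleftrightarrow> rel s G (f u) (f v)" for u v
      by blast+
    have G: "is_graph G" using assms that by (auto simp: hereditary_def)
    let ?H = "if s then H else graph_compl H"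
    have "{u, v} \<in> edges ?H \<longleftrightarrow> {f u, f v} \<in> edges G" if uv: "u \<in> verts H" "v \<in> verts H" for u v
    proof (cases "u = v")
      case True
      then show ?thesis using G is_graph_compl[OF H] H
        by (auto simp: is_graph_def graph_compl_def)
    next
      case False
      then have "f u \<noteq> f v" using f(1) uv by (meson inj_onD)
      moreover have "card {u, v} = 2" using False by simp
      ultimately show ?thesis using f(3)[OF uv] uv by (auto simp: rel_def graph_compl_def)
    qed
    moreover have "verts ?H = verts H" by (simp add: graph_compl_def)
    moreover have "is_graph ?H" using H is_graph_compl[OF H] by simp
    ultimately have "?H \<in> C"
      using assms(1) that f by (intro hereditary_embedding[of C G ?H f]) auto
    with assms(3) show False by blast
  qed
  then show ?thesis by blast
qed

section \<open>Lower bound: cuts with many distinct neighbourhoods\<close>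

text \<open>These are the distinct nonzero rows of the adjacency matrix across the cut
  \<open>A\<close> within \<open>W\<close>. Dropping the empty row makes nonemptiness say that a
  related pair crosses the cut.\<close>

definition traces :: "('a \<Rightarrow> 'a \<Rightarrow> bool) \<Rightarrow> 'a set \<Rightarrow> 'a set \<Rightarrow> 'a set set" where
  "traces R A W = (\<lambda>x. {y \<in> W - A. R x y}) ` (W \<inter> A) - {{}}"

text \<open>The traces found within \<open>W2\<close> stay distinct in \<open>W\<close>, and
  \<open>r\<close> yields another. If \<open>r\<close> lies in \<open>A2\<close>, its trace reaches
  \<open>W3\<close>, which no vertex of \<open>W2\<close> sees. Otherwise some vertex of
  \<open>W1\<close> in \<open>A2\<close> has a trace that contains \<open>r\<close> but misses
  \<open>W2\<close>.\<close>

lemma traces_step: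
  assumes "finite W" "symp R" "r \<in> W" "W1 \<subseteq> W" "W2 \<subseteq> W" "W3 \<subseteq> W"
    "r \<notin> W1 \<union> W2 \<union> W3" "\<forall>x \<in> W1 \<union> W2 \<union> W3. R r x"
    "\<forall>x\<in>W1. \<forall>y\<in>W2. \<not> R x y" "\<forall>x\<in>W2. \<forall>y\<in>W3. \<not> R x y"
    "A1 \<subseteq> A2" "A2 \<subseteq> A3" "traces R A1 W1 \<noteq> {}" "traces R A3 W3 \<noteq> {}"
    "k \<le> card (traces R A2 W2)"
  shows "Suc k \<le> card (traces R A2 W)"
proof -
  let ?t = "\<lambda>x. {y \<in> W - A2. R x y}"
  define M where "M = {?t x | x. x \<in> W2 \<inter> A2 \<and> ?t x \<inter> W2 \<noteq> {}}"
  have fin: "finite (traces R A2 W)" unfolding traces_def using assms(1) by simp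
  have sub: "M \<subseteq> traces R A2 W" unfolding M_def traces_def using assms(5) by blast
  have fM: "finite M" using fin sub finite_subset by blast
  \<comment> \<open>Intersecting with \<open>W2\<close> maps \<open>M\<close> onto the traces within
    \<open>W2\<close>, so \<open>M\<close> has at least \<open>k\<close> members.\<close>
  have "traces R A2 W2 \<subseteq> (\<lambda>T. T \<inter> W2) ` M"
  proof
    fix T assume "T \<in> traces R A2 W2"
    then obtain x where x: "x \<in> W2 \<inter> A2" "T = {y \<in> W2 - A2. R x y}" "T \<noteq> {}"
      unfolding traces_def by blast
    then have "T = ?t x \<inter> W2" using assms(5) by blast
    then show "T \<in> (\<lambda>T. T \<inter> W2) ` M" using x unfolding M_def by blast
  qed
  then have kM: "k \<le> card M"
    using assms(15) surj_card_le[OF fM] by (meson le_trans)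
  \<comment> \<open>A pair crossing \<open>A1\<close> in \<open>W1\<close> has an end in
    \<open>A1\<close>, hence in \<open>A2\<close>; a pair crossing \<open>A3\<close> in
    \<open>W3\<close> has an end outside \<open>A3\<close>, hence outside \<open>A2\<close>.\<close>
  obtain x z where x: "x \<in> W1" "x \<in> A2" and z: "z \<in> W3" "z \<notin> A2"
    using assms(11-14) unfolding traces_def by blast
  have "\<exists>T. T \<in> traces R A2 W \<and> T \<notin> M"
  proof (cases "r \<in> A2")
    case True
    have "z \<in> ?t r" using z assms(6,8) by blast
    then have "?t r \<in> traces R A2 W" unfolding traces_def using True assms(3) by blast
    moreover have "z \<notin> T" if "T \<in> M" for T using that assms(10) z unfolding M_def by blast
    ultimately show ?thesis using \<open>z \<in> ?t r\<close> by blast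
  next
    case False
    have "r \<in> ?t x" using x False assms(3,8) \<open>symp R\<close> by (auto dest: sympD)
    then have "?t x \<in> traces R A2 W" unfolding traces_def using x assms(4) by blast
    moreover have "?t x \<inter> W2 = {}" using x assms(9) by blast
    then have "?t x \<notin> M" unfolding M_def by blast
    ultimately show ?thesis by blast
  qed
  then obtain T where "T \<in> traces R A2 W" "T \<notin> M" by blast
  then have "card (insert T M) \<le> card (traces R A2 W)" using sub fin by (intro card_mono) auto
  then show ?thesis using kM fM \<open>T \<notin> M\<close> by simp
qed

text \<open>As for the path-width of ternary trees: of three disjoint copies, take the cut that is good
  for the copy whose turn is in the middle; the copy before and the copy after it, together with
  the common neighbour, yield one more trace. Two levels of the binary recursion of
  \<^const>\<open>rich\<close> provide the three copies.\<close>

lemma rich_traces: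
  assumes chain: "\<And>A B. A \<in> \<A> \<Longrightarrow> B \<in> \<A> \<Longrightarrow> A \<subseteq> B \<or> B \<subseteq> A"
    and sep: "\<And>u v. u \<in> V \<Longrightarrow> v \<in> V \<Longrightarrow> u \<noteq> v \<Longrightarrow> \<exists>A\<in>\<A>. u \<in> A \<longleftrightarrow> v \<notin> A"
    and R: "symp R" and fin: "finite V"
  shows "rich R (Suc (2 * k)) W \<Longrightarrow> W \<subseteq> V \<Longrightarrow> \<exists>A\<in>\<A>. Suc k \<le> card (traces R A W)"
proof (induction k arbitrary: W)
  case 0
  \<comment> \<open>Level 1 provides a related pair; a cut that separates the pair has a nonempty
    trace.\<close>
  then obtain v U where "v \<in> W" "U \<subseteq> W" "v \<notin> U" "\<forall>x\<in>U. R v x" "rich R 0 U"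
    using separated_rich_imp by (metis mult_0_right rich.simps(2))
  then obtain u where uv: "u \<in> W" "u \<noteq> v" "R v u" "R u v" "v \<in> W"
    using R by (auto dest: sympD)
  then obtain A where A: "A \<in> \<A>" "u \<in> A \<longleftrightarrow> v \<notin> A" using sep 0 by (meson subsetD)
  have "traces R A W \<noteq> {}"
    using uv A(2) unfolding traces_def by (cases "u \<in> A") blast+
  moreover have "finite (traces R A W)"
    using fin 0 finite_subset unfolding traces_def by blast
  ultimately have "Suc 0 \<le> card (traces R A W)" by (simp add: card_gt_0_iff Suc_le_eq)
  then show ?case using A(1) by blast
next
  case (Suc k)
  have "rich R (Suc (Suc (Suc (2 * k)))) W" using Suc.prems by simp
  then obtain r U where r: "r \<in> W" "U \<subseteq> W" "r \<notin> U" "\<forall>x\<in>U. R r x"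
    "separated R (rich R (Suc (Suc (2 * k)))) U"
    unfolding rich.simps(2)[of R "Suc (Suc (2 * k))"] by blast
  then obtain U1 U2 where U: "U1 \<subseteq> U" "U2 \<subseteq> U" "\<forall>x\<in>U1. \<forall>y\<in>U2. \<not> R x y"
    "rich R (Suc (Suc (2 * k))) U1" "rich R (Suc (Suc (2 * k))) U2"
    unfolding separated_def by blast
  \<comment> \<open>The second level is split only inside \<open>U1\<close>; \<open>U2\<close> is
    the third part as a whole and merely drops to the same level.\<close>
  have W3: "rich R (Suc (2 * k)) U2" using U(5) by (rule rich_Suc_imp)
  obtain W1 W2 where W: "W1 \<subseteq> U1" "W2 \<subseteq> U1" "\<forall>x\<in>W1. \<forall>y\<in>W2. \<not> R x y"
    "rich R (Suc (2 * k)) W1" "rich R (Suc (2 * k)) W2"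
    using rich_Suc_separated[OF U(4)] unfolding separated_def by (elim exE conjE)
  have sub: "W1 \<subseteq> W" "W2 \<subseteq> W" "U2 \<subseteq> W" using r U W by auto
  have sV: "W1 \<subseteq> V" "W2 \<subseteq> V" "U2 \<subseteq> V" using sub Suc.prems(2) by auto
  obtain A1 A2 A3 where A: "A1 \<in> \<A>" "Suc k \<le> card (traces R A1 W1)"
     "A2 \<in> \<A>" "Suc k \<le> card (traces R A2 W2)" "A3 \<in> \<A>" "Suc k \<le> card (traces R A3 U2)"
    using Suc.IH[OF W(4) sV(1)] Suc.IH[OF W(5) sV(2)] Suc.IH[OF W3 sV(3)] by blast
  have ne: "traces R A1 W1 \<noteq> {}" "traces R A2 W2 \<noteq> {}" "traces R A3 U2 \<noteq> {}"
    using A by auto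
  have fW: "finite W" using fin Suc.prems finite_subset by blast
  have rW: "r \<notin> W1" "r \<notin> W2" "r \<notin> U2" "\<forall>x\<in>W1. R r x" "\<forall>x\<in>W2. R r x" "\<forall>x\<in>U2. R r x"
    using r U W by auto
  have na: "\<forall>x\<in>W1. \<forall>y\<in>W2. \<not> R x y" "\<forall>x\<in>W2. \<forall>y\<in>W1. \<not> R x y"
    "\<forall>x\<in>W1. \<forall>y\<in>U2. \<not> R x y" "\<forall>x\<in>U2. \<forall>y\<in>W1. \<not> R x y"
    "\<forall>x\<in>W2. \<forall>y\<in>U2. \<not> R x y" "\<forall>x\<in>U2. \<forall>y\<in>W2. \<not> R x y"
    using W(1-3) U(1-3) R by (meson subsetD sympD)+
  note step = traces_step[OF fW R r(1)]
  consider "A1 \<subseteq> A2" "A2 \<subseteq> A3" | "A3 \<subseteq> A2" "A2 \<subseteq> A1" | "A2 \<subseteq> A1" "A1 \<subseteq> A3"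
    | "A3 \<subseteq> A1" "A1 \<subseteq> A2" | "A1 \<subseteq> A3" "A3 \<subseteq> A2" | "A2 \<subseteq> A3" "A3 \<subseteq> A1"
    using chain A by metis
  then show ?case
  proof cases
    case 1
    then show ?thesis using step[of W1 W2 U2 A1 A2 A3 "Suc k"] A ne sub rW na by blast
  next
    case 2
    then show ?thesis using step[of U2 W2 W1 A3 A2 A1 "Suc k"] A ne sub rW na by blast
  next
    case 3
    then show ?thesis using step[of W2 W1 U2 A2 A1 A3 "Suc k"] A ne sub rW na by blast
  next
    case 4
    then show ?thesis using step[of U2 W1 W2 A3 A1 A2 "Suc k"] A ne sub rW na by blast
  next
    case 5
    then show ?thesis using step[of W1 U2 W2 A1 A3 A2 "Suc k"] A ne sub rW na by blast
  next
    case 6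
    then show ?thesis using step[of W2 U2 W1 A2 A3 A1 "Suc k"] A ne sub rW na by blast
  qed
qed

text \<open>The cuts are the vertex sets at the times when a vertex is added, coloured by the labels at
  that time: vertices with equal labels are treated alike ever after.\<close>

lemma lcw_built_cuts:
  assumes "lcw_built S G l"
  shows "dom l = verts G \<and> ran l \<subseteq> S \<and> (\<forall>e\<in>edges G. e \<subseteq> verts G) \<and>
    (\<exists>\<A>. (\<forall>A\<in>\<A>. A \<subseteq> verts G) \<and> (\<forall>A\<in>\<A>. \<forall>B\<in>\<A>. A \<subseteq> B \<or> B \<subseteq> A) \<and>
      (\<forall>u\<in>verts G. \<forall>v\<in>verts G. u \<noteq> v \<longrightarrow> (\<exists>A\<in>\<A>. u \<in> A \<longleftrightarrow> v \<notin> A)) \<and>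
      (\<forall>A\<in>\<A>. \<exists>f. f ` A \<subseteq> S \<and> (\<forall>x\<in>A. \<forall>x'\<in>A. f x = f x' \<longrightarrow> l x = l x' \<and>
         (\<forall>y\<in>verts G - A. {x, y} \<in> edges G \<longleftrightarrow> {x', y} \<in> edges G))))"
  using assms
proof (induction rule: lcw_built.induct)
  case empty
  show ?case by (auto intro: exI[of _ "{}"])
next
  case (add_vertex V E l v i)
  obtain \<A> where d: "dom l = V" "ran l \<subseteq> S" "\<forall>e\<in>E. e \<subseteq> V"
    and A: "\<forall>A\<in>\<A>. A \<subseteq> V" "\<forall>A\<in>\<A>. \<forall>B\<in>\<A>. A \<subseteq> B \<or> B \<subseteq> A"
      "\<forall>u\<in>V. \<forall>v\<in>V. u \<noteq> v \<longrightarrow> (\<exists>A\<in>\<A>. u \<in> A \<longleftrightarrow> v \<notin> A)"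
      "\<forall>A\<in>\<A>. \<exists>f. f ` A \<subseteq> S \<and> (\<forall>x\<in>A. \<forall>x'\<in>A. f x = f x' \<longrightarrow> l x = l x' \<and>
         (\<forall>y\<in>V - A. {x, y} \<in> E \<longleftrightarrow> {x', y} \<in> E))"
    using add_vertex.IH unfolding fst_conv snd_conv by (elim conjE exE)
  let ?l = "l(v := Some i)"
  have nE: "{x, v} \<notin> E" for x using d(3) add_vertex(2) by auto
  \<comment> \<open>The new cut \<open>V\<close> is coloured by the current labels, and older cuts
    keep their colourings. The vertex \<open>v\<close> has no edges yet, so it distinguishes no two
    vertices of a cut.\<close>
  have cuts: "\<exists>f. f ` A \<subseteq> S \<and> (\<forall>x\<in>A. \<forall>x'\<in>A. f x = f x' \<longrightarrow> ?l x = ?l x' \<and>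
         (\<forall>y\<in>insert v V - A. {x, y} \<in> E \<longleftrightarrow> {x', y} \<in> E))" if "A \<in> insert V \<A>" for A
  proof (cases "A = V")
    case True
    have "(\<lambda>x. the (l x)) ` V \<subseteq> S" using d(1,2) by (force simp: ran_def)
    moreover have "l x = l x'" if "x \<in> V" "x' \<in> V" "the (l x) = the (l x')" for x x'
      using that d(1) by (metis domD option.sel)
    ultimately show ?thesis using True nE add_vertex(2)
      by (intro exI[of _ "\<lambda>x. the (l x)"]) auto
  next
    case False
    then have "A \<in> \<A>" using that by blast
    obtain f where f: "f ` A \<subseteq> S" "\<forall>x\<in>A. \<forall>x'\<in>A. f x = f x' \<longrightarrow> l x = l x' \<and>
         (\<forall>y\<in>V - A. {x, y} \<in> E \<longleftrightarrow> {x', y} \<in> E)"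
      using A(4)[rule_format, OF \<open>A \<in> \<A>\<close>] by (elim exE conjE)
    have AV: "A \<subseteq> V" using A(1) \<open>A \<in> \<A>\<close> by blast
    have "v \<notin> A" using AV add_vertex(2) by blast
    then have lA: "?l x = l x" if "x \<in> A" for x using that by auto
    show ?thesis
    proof (intro exI[of _ f] conjI ballI impI)
      show "f ` A \<subseteq> S" by (rule f(1))
      fix x x' assume x: "x \<in> A" "x' \<in> A" "f x = f x'"
      show "?l x = ?l x'" using f(2)[rule_format, OF x] lA x(1,2) by simp
      show "{x, y} \<in> E \<longleftrightarrow> {x', y} \<in> E" if "y \<in> insert v V - A" for y
        using f(2)[rule_format, OF x] nE that by (cases "y = v") simp_all
    qed
  qed
  \<comment> \<open>The cut \<open>V\<close> separates \<open>v\<close> from every older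
    vertex.\<close>
  have "\<forall>u\<in>insert v V. \<forall>w\<in>insert v V. u \<noteq> w \<longrightarrow> (\<exists>A\<in>insert V \<A>. u \<in> A \<longleftrightarrow> w \<notin> A)"
    using A(3) add_vertex(2) by blast
  moreover have "\<forall>A\<in>insert V \<A>. \<forall>B\<in>insert V \<A>. A \<subseteq> B \<or> B \<subseteq> A" using A(1,2) by blast
  moreover have "\<forall>A\<in>insert V \<A>. A \<subseteq> insert v V" using A(1) by blast
  moreover have "dom ?l = insert v V" using d by simp
  moreover have "ran ?l \<subseteq> S" using d add_vertex by (auto simp: ran_def)
  moreover have "\<forall>e\<in>E. e \<subseteq> insert v V" using d by blast
  ultimately show ?case unfolding fst_conv snd_conv
    by (intro conjI exI[of _ "insert V \<A>"]) (assumption | rule ballI, rule cuts, assumption)+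
next
  case (add_edges V E l i j)
  obtain \<A> where d: "dom l = V" "ran l \<subseteq> S" "\<forall>e\<in>E. e \<subseteq> V"
    and A: "\<forall>A\<in>\<A>. A \<subseteq> V" "\<forall>A\<in>\<A>. \<forall>B\<in>\<A>. A \<subseteq> B \<or> B \<subseteq> A"
      "\<forall>u\<in>V. \<forall>v\<in>V. u \<noteq> v \<longrightarrow> (\<exists>A\<in>\<A>. u \<in> A \<longleftrightarrow> v \<notin> A)"
      "\<forall>A\<in>\<A>. \<exists>f. f ` A \<subseteq> S \<and> (\<forall>x\<in>A. \<forall>x'\<in>A. f x = f x' \<longrightarrow> l x = l x' \<and>
         (\<forall>y\<in>V - A. {x, y} \<in> E \<longleftrightarrow> {x', y} \<in> E))"
    using add_edges.IH unfolding fst_conv snd_conv by (elim conjE exE)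
  let ?E = "E \<union> {{u, v} | u v. l u = Some i \<and> l v = Some j}"
  have E: "{x, y} \<in> ?E \<longleftrightarrow> {x, y} \<in> E \<or> l x = Some i \<and> l y = Some j \<or> l x = Some j \<and> l y = Some i"
    for x y by (auto simp: doubleton_eq_iff)
  \<comment> \<open>Equal colours imply equal current labels, and whether an edge is added depends
    on labels alone.\<close>
  have cuts: "\<exists>f. f ` A \<subseteq> S \<and> (\<forall>x\<in>A. \<forall>x'\<in>A. f x = f x' \<longrightarrow> l x = l x' \<and>
         (\<forall>y\<in>V - A. {x, y} \<in> ?E \<longleftrightarrow> {x', y} \<in> ?E))" if A': "A \<in> \<A>" for A
  proof -
    obtain f where f: "f ` A \<subseteq> S" "\<forall>x\<in>A. \<forall>x'\<in>A. f x = f x' \<longrightarrow> l x = l x' \<and>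
         (\<forall>y\<in>V - A. {x, y} \<in> E \<longleftrightarrow> {x', y} \<in> E)"
      using A(4)[rule_format, OF A'] by (elim exE conjE)
    show ?thesis unfolding E
    proof (intro exI[of _ f] conjI ballI impI)
      show "f ` A \<subseteq> S" by (rule f(1))
      fix x x' assume "x \<in> A" "x' \<in> A" "f x = f x'"
      note f' = f(2)[rule_format, OF this]
      show "l x = l x'" using f' by blast
      show "({x, y} \<in> E \<or> l x = Some i \<and> l y = Some j \<or> l x = Some j \<and> l y = Some i) \<longleftrightarrow>
          ({x', y} \<in> E \<or> l x' = Some i \<and> l y = Some j \<or> l x' = Some j \<and> l y = Some i)"
        if "y \<in> V - A" for y
        using f' that by simp
    qed
  qed
  have "\<forall>e\<in>?E. e \<subseteq> V" using d by auto
  then show ?case using d(1,2) A(1-3) unfolding fst_conv snd_conv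
    by (intro conjI exI[of _ \<A>]) (assumption | rule ballI, rule cuts, assumption)+
next
  case (relabel V E l i j)
  obtain \<A> where d: "dom l = V" "ran l \<subseteq> S" "\<forall>e\<in>E. e \<subseteq> V"
    and A: "\<forall>A\<in>\<A>. A \<subseteq> V" "\<forall>A\<in>\<A>. \<forall>B\<in>\<A>. A \<subseteq> B \<or> B \<subseteq> A"
      "\<forall>u\<in>V. \<forall>v\<in>V. u \<noteq> v \<longrightarrow> (\<exists>A\<in>\<A>. u \<in> A \<longleftrightarrow> v \<notin> A)"
      "\<forall>A\<in>\<A>. \<exists>f. f ` A \<subseteq> S \<and> (\<forall>x\<in>A. \<forall>x'\<in>A. f x = f x' \<longrightarrow> l x = l x' \<and>
         (\<forall>y\<in>V - A. {x, y} \<in> E \<longleftrightarrow> {x', y} \<in> E))"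
    using relabel.IH unfolding fst_conv snd_conv by (elim conjE exE)
  let ?l = "\<lambda>v. if l v = Some i then Some j else l v"
  \<comment> \<open>The new label is a function of the old one, so equal labels stay equal.\<close>
  have cuts: "\<exists>f. f ` A \<subseteq> S \<and> (\<forall>x\<in>A. \<forall>x'\<in>A. f x = f x' \<longrightarrow> ?l x = ?l x' \<and>
         (\<forall>y\<in>V - A. {x, y} \<in> E \<longleftrightarrow> {x', y} \<in> E))" if A': "A \<in> \<A>" for A
  proof -
    obtain f where f: "f ` A \<subseteq> S" "\<forall>x\<in>A. \<forall>x'\<in>A. f x = f x' \<longrightarrow> l x = l x' \<and>
         (\<forall>y\<in>V - A. {x, y} \<in> E \<longleftrightarrow> {x', y} \<in> E)"
      using A(4)[rule_format, OF A'] by (elim exE conjE)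
    show ?thesis
    proof (intro exI[of _ f] conjI ballI impI)
      show "f ` A \<subseteq> S" by (rule f(1))
      fix x x' assume "x \<in> A" "x' \<in> A" "f x = f x'"
      note f' = f(2)[rule_format, OF this]
      show "?l x = ?l x'" using f' by simp
      show "{x, y} \<in> E \<longleftrightarrow> {x', y} \<in> E" if "y \<in> V - A" for y
        using f' that by simp
    qed
  qed
  have "dom ?l = V" using d(1) by (auto split: if_splits)
  moreover have "ran ?l \<subseteq> S" using d(2) relabel by (auto simp: ran_def)
  ultimately show ?case using d(3) A(1-3) unfolding fst_conv snd_conv
    by (intro conjI exI[of _ \<A>]) (assumption | rule ballI, rule cuts, assumption)+
qed

text \<open>Each colour of a cut accounts for at most one trace and colours are letters, whereas
  richness forces \<open>Suc k\<close> traces at some cut.\<close>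

lemma rich_lcw:
  assumes "is_graph G" "rich (rel s G) (Suc (2 * k)) (verts G)"
  shows "k < lcw G"
proof -
  let ?P = "\<lambda>k. \<exists>S :: nat set. finite S \<and> card S = k \<and> lcw_constructible S G"
  have "\<exists>k. ?P k" using lcw_constructible_exists[OF assms(1)] by blast
  then have "?P (lcw G)" unfolding lcw_def by (rule LeastI_ex)
  then obtain S :: "nat set" and l where S: "finite S" "card S = lcw G" "lcw_built S G l"
    unfolding lcw_constructible_def by blast
  obtain \<A> where A: "\<forall>A\<in>\<A>. \<forall>B\<in>\<A>. A \<subseteq> B \<or> B \<subseteq> A"
      "\<forall>u\<in>verts G. \<forall>v\<in>verts G. u \<noteq> v \<longrightarrow> (\<exists>A\<in>\<A>. u \<in> A \<longleftrightarrow> v \<notin> A)"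
      "\<forall>A\<in>\<A>. \<exists>f. f ` A \<subseteq> S \<and> (\<forall>x\<in>A. \<forall>x'\<in>A. f x = f x' \<longrightarrow> l x = l x' \<and>
         (\<forall>y\<in>verts G - A. {x, y} \<in> edges G \<longleftrightarrow> {x', y} \<in> edges G))"
    using lcw_built_cuts[OF S(3)] by (elim conjE exE)
  have fin: "finite (verts G)" using assms by (simp add: is_graph_def)
  have "\<exists>A\<in>\<A>. Suc k \<le> card (traces (rel s G) A (verts G))"
  proof (rule rich_traces[OF _ _ symp_rel fin assms(2) subset_refl])
    show "A \<subseteq> B \<or> B \<subseteq> A" if "A \<in> \<A>" "B \<in> \<A>" for A B
      using A(1)[rule_format, OF that] .
    show "\<exists>A\<in>\<A>. u \<in> A \<longleftrightarrow> v \<notin> A" if "u \<in> verts G" "v \<in> verts G" "u \<noteq> v" for u v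
      using A(2)[rule_format, OF that] .
  qed
  then obtain A where A': "A \<in> \<A>" and c: "Suc k \<le> card (traces (rel s G) A (verts G))"
    by blast
  obtain f where f: "f ` A \<subseteq> S" "\<forall>x\<in>A. \<forall>x'\<in>A. f x = f x' \<longrightarrow> l x = l x' \<and>
         (\<forall>y\<in>verts G - A. {x, y} \<in> edges G \<longleftrightarrow> {x', y} \<in> edges G)"
    using A(3)[rule_format, OF A'] by (elim exE conjE)
  let ?t = "\<lambda>x. {y \<in> verts G - A. rel s G x y}"
  let ?X = "verts G \<inter> A"
  \<comment> \<open>Equal neighbourhoods outside \<open>A\<close> also mean equal non-neighbourhoods
    there, so both values of \<open>s\<close> are covered.\<close>
  have t: "?t x = ?t x'" if "x \<in> ?X" "x' \<in> ?X" "f x = f x'" for x x'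
    using that f(2) by (auto simp: rel_def)
  \<comment> \<open>Any vertex of colour \<open>i\<close> can represent its colour class, as all its
    members have the same trace.\<close>
  define g where "g i = ?t (SOME x. x \<in> ?X \<and> f x = i)" for i
  have "?t x = g (f x)" if "x \<in> ?X" for x
  proof -
    have "(SOME x'. x' \<in> ?X \<and> f x' = f x) \<in> ?X \<and> f (SOME x'. x' \<in> ?X \<and> f x' = f x) = f x"
      by (rule someI[of _ x]) (use that in auto)
    then show ?thesis unfolding g_def using t that by blast
  qed
  then have "traces (rel s G) A (verts G) \<subseteq> g ` S"
    unfolding traces_def using f(1) by blast
  then have "card (traces (rel s G) A (verts G)) \<le> card S"
    using S(1) surj_card_le by blast
  then show ?thesis using c S by simp
qed

section \<open>Universal graphs and the equivalence\<close>

text \<open>This constructs \<open>E k\<close> on natural numbers. Since the bound \<open>n\<close>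
  varies in the induction, the second copy can start beyond the first, and \<open>n\<close> itself
  remains free for the root.\<close>

lemma exists_rich_quasi_threshold:
  "\<exists>G :: nat sgraph. quasi_threshold G \<and> verts G \<subseteq> {n..} \<and> rich (rel True G) k (verts G)"
proof (induction k arbitrary: n)
  case 0
  show ?case by (intro exI[of _ "K1 n"]) (auto intro: quasi_threshold.intros)
next
  case (Suc k)
  obtain G :: "nat sgraph"
    where G: "quasi_threshold G" "verts G \<subseteq> {Suc n..}" "rich (rel True G) k (verts G)"
    using Suc.IH by blast
  have gG: "is_graph G" using G quasi_threshold_is_graph by blast
  then obtain m where m: "\<And>x. x \<in> verts G \<Longrightarrow> x < m"
    unfolding is_graph_def by (metis finite_nat_set_iff_bounded)
  obtain H :: "nat sgraph"
    where H: "quasi_threshold H" "verts H \<subseteq> {max (Suc n) m..}" "rich (rel True H) k (verts H)"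
    using Suc.IH by blast
  have gH: "is_graph H" using H quasi_threshold_is_graph by blast
  have dj: "verts G \<inter> verts H = {}" using H m by fastforce
  let ?U = "comb True G H"
  let ?K = "comb False ?U (K1 n)"
  have gU: "is_graph ?U" using is_graph_comb gG gH dj by blast
  have n: "n \<notin> verts ?U" using G H by fastforce
  have qU: "quasi_threshold ?U" using quasi_threshold.intros(2)[OF G(1) H(1) dj] by (simp add: comb_def)
  have qK: "quasi_threshold ?K" using quasi_threshold.intros(3)[OF qU n] by (simp add: comb_def)
  have gn: "is_graph (K1 n)" by (simp add: is_graph_def)
  note rU = rel_comb[OF gG gH dj, where s = True and t = True]
  have dj': "verts ?U \<inter> verts (K1 n) = {}" using n by simp
  note rK = rel_comb[OF gU gn dj', where s = False and t = True]
  have "rich (rel True ?U) k (verts G)" using rich_cong_imp[OF G(3)] rU(1) by blast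
  moreover have "rich (rel True ?U) k (verts H)" using rich_cong_imp[OF H(3)] rU(2) by blast
  ultimately have "separated (rel True ?U) (rich (rel True ?U) k) (verts ?U)"
    unfolding separated_def using dj rU(3)
    by (intro exI[of _ "verts G"] exI[of _ "verts H"]) auto
  then have "separated (rel True ?K) (rich (rel True ?K) k) (verts ?U)"
    by (rule separated_rich_cong_imp) (use rK(1) in blast)
  moreover have "\<forall>x\<in>verts ?U. rel True ?K n x"
    using rK(3) symp_rel by (metis singletonI fst_conv sympD)
  ultimately have "rich (rel True ?K) (Suc k) (verts ?K)"
    unfolding rich.simps using n by (intro bexI[of _ n] exI[of _ "verts ?U"]) auto
  moreover have "verts ?K \<subseteq> {n..}" using G H by auto
  ultimately show ?case using qK by blast
qed

lemma rel_graph_compl: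
  assumes "u \<in> verts G" "v \<in> verts G"
  shows "rel (\<not> s) (graph_compl G) u v \<longleftrightarrow> rel s G u v"
  using assms by (auto simp: rel_def graph_compl_def)

theorem theorem1p1:
  fixes C :: "nat sgraph set"
  assumes "hereditary C"
    and "\<forall>G\<in>C. cograph G"
  shows "bounded_lcw C \<longleftrightarrow>
    (\<exists>G. quasi_threshold G \<and> G \<notin> C) \<and> (\<exists>G. quasi_threshold G \<and> graph_compl G \<notin> C)"
proof
  assume "bounded_lcw C"
  then obtain c where c: "\<And>G. G \<in> C \<Longrightarrow> lcw G \<le> c" unfolding bounded_lcw_def by blast
  obtain G :: "nat sgraph"
    where G: "quasi_threshold G" "rich (rel True G) (Suc (2 * c)) (verts G)"
    using exists_rich_quasi_threshold by blast
  have g: "is_graph G" using G quasi_threshold_is_graph by blast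
  have "c < lcw G" using rich_lcw[OF g G(2)] .
  then have 1: "G \<notin> C" using c by (meson not_less)
  \<comment> \<open>Distinct vertices are non-adjacent in the complement exactly if they are
    adjacent in \<open>G\<close>, so the lower bound with \<open>s = False\<close> applies.\<close>
  have "rich (rel False (graph_compl G)) (Suc (2 * c)) (verts G)"
    by (rule rich_cong_imp[OF G(2)]) (use rel_graph_compl[of _ G _ True] in simp)
  then have "c < lcw (graph_compl G)"
    using rich_lcw[OF is_graph_compl[OF g], of False c] by (simp add: graph_compl_def)
  then have "graph_compl G \<notin> C" using c by (meson not_less)
  with 1 G(1) show "(\<exists>G. quasi_threshold G \<and> G \<notin> C) \<and> (\<exists>G. quasi_threshold G \<and> graph_compl G \<notin> C)"
    by blast
next
  assume "(\<exists>G. quasi_threshold G \<and> G \<notin> C) \<and> (\<exists>G. quasi_threshold G \<and> graph_compl G \<notin> C)"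
  then obtain H H' where H: "quasi_threshold H" "H \<notin> C" "quasi_threshold H'" "graph_compl H' \<notin> C"
    by blast
  obtain a where a: "\<forall>G\<in>C. \<not> rich (rel True G) a (verts G)"
    using excluded_not_rich[of C H True] H assms(1) by auto
  obtain b where b: "\<forall>G\<in>C. \<not> rich (rel False G) b (verts G)"
    using excluded_not_rich[of C H' False] H assms(1) by auto
  have "lcw G \<le> Suc (a + b)" if "G \<in> C" for G
  proof (rule strahler_lcw)
    \<comment> \<open>A set containing a separated pair of rich sets is itself rich at that level,
      so the lack of richness excludes such pairs.\<close>
    have "\<not> separated (rel True G) (rich (rel True G) a) (verts G)"
      "\<not> separated (rel (\<not> True) G) (rich (rel (\<not> True) G) b) (verts G)"
      using a b that separated_rich_imp[of "rel True G" a] separated_rich_imp[of "rel False G" b] by auto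
    then show "strahler (Suc (a + b)) G"
      using cograph_strahler[of G] assms(2) that by blast
  qed
  then show "bounded_lcw C" unfolding bounded_lcw_def by blast
qed

end
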